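(* Suppose the following assumptions hold: (i) $w^\dagger$ is the unique solution of $\min_{w\in\mathbb{R}^p} R_\alpha(w)$ subject to $Xw=y^\dagger$, and the noiseless dual gradient descent iterates satisfy $v_0^{(k)}\to v^\dagger$ as $k\to\infty$, where $v^\dagger$ is a solution of the noiseless dual problem $\min_{v\in\mathbb{R}^n} R_\alpha^*(-X^\top v)+\langle y^\dagger,v\rangle$; (ii) (nondegenerate source condition) $z^\dagger:=-X^\top v^\dagger\in \mathrm{ri}(\partial R_\alpha(w^\dagger))$; (iii) $R$ is partly smooth at $w^\dagger$ relative to a set $\mathcal{M}_{w^\dagger}\subset\mathbb{R}^p$; (iv) given $\epsilon>0$, with $$\mathcal{U}_\epsilon=\bigcup_{w\in\mathcal{M}_{w^\dagger}\cap\mathcal{B}(w^\dagger,\epsilon)}\big(w+\partial R_\alpha(w)\big),$$ the strong convexity constant $\alpha$ is chosen such that $$\alpha\, c_\delta\,\|X\|^{-1}<\mathrm{dist}\big(w^\dagger+z^\dagger,\ \mathrm{bdy}(\mathcal{U}_\epsilon)\big),$$ where $c_\delta$ is the constant defined by $k_\delta=c_\delta\delta^{-1}$. Let $k_\delta$ be the optimal early stopping time of dual gradient descent and $w_\delta^{(k_\delta)}$ the corresponding iterate. Then, when $\delta>0$ is small enough, $$w_\delta^{(k_\delta)}\in\mathcal{M}_{w^\dagger}.$$ Moreover, there exist $0<\underline{k}<k_\delta<\overline{k}$ such that $w_\delta^{(k)}\in\mathcal{M}_{w^\dagger}$ holds for all $k\in[\underline{k},\overline{k}]$.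
   Context: Setting. $X\in\mathbb{R}^{n\times p}$ is a nonzero matrix, $\|X\|$ its operator norm, $w^\dagger\in\mathbb{R}^p$, $y^\dagger=Xw^\dagger$. For each noise level $\delta\in(0,1)$, $y_\delta\in\mathbb{R}^n$ is a noisy observation in the range of $X$ with $\|y_\delta-y^\dagger\|\le\delta$; for $\delta=0$, $y_0=y^\dagger$. $R:\mathbb{R}^p\to\mathbb{R}\cup\{+\infty\}$ is proper, convex and lower semicontinuous; for $\alpha>0$, $R_\alpha(w)=R(w)+\frac{\alpha}{2}\|w\|^2$. The problem to be solved from noisy data is $\min_w R_\alpha(w)$ subject to $Xw=y_\delta$, with dual $\min_v R_\alpha^*(-X^\top v)+\langle y_\delta,v\rangle$. $R_\alpha^*$ is the convex conjugate of $R_\alpha$, $\partial$ the convex subdifferential, $\mathrm{prox}_{\gamma R}(w)=\arg\min_{w'}\{R(w')+\frac1{2\gamma}\|w'-w\|^2\}$, $\mathrm{ri}$ the relative interior, $\mathrm{bdy}$ the topological boundary, $\mathrm{dist}$ the Euclidean distance from a point to a set, $\mathcal{B}(w,\epsilon)$ the open ball. Dual gradient descent (DGD). With $\gamma=\alpha\|X\|^{-2}$ and $v_\delta^{(0)}=0$, for $k=0,1,2,\dots$: $z_\delta^{(k)}=-X^\top v_\delta^{(k)}$, $w_\delta^{(k)}=\mathrm{prox}_{\alpha^{-1}R}(\alpha^{-1}z_\delta^{(k)})$, $v_\delta^{(k+1)}=v_\delta^{(k)}+\gamma(Xw_\delta^{(k)}-y_\delta)$. The noiseless iterates $v_0^{(k)},w_0^{(k)},z_0^{(k)}$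 are those with $\delta=0$ ($y_0=y^\dagger$). Optimal early stopping time of DGD, and $c_\delta$. The early stopping time $k_\delta$ is the one furnished by the following stability estimate for DGD: with $a=2\|X\|^{-1}$ and $b=\|X\|\,\|v^\dagger\|\,\alpha^{-1}$, for any $c\ge\delta$ and $k_\delta\in\{\lfloor c\delta^{-1}\rfloor,\dots,2\lfloor c\delta^{-1}\rfloor\}$ one has $\|w_\delta^{(k_\delta)}-w^\dagger\|\le\big(a(c^{1/2}+1)+bc^{-1/2}\big)\delta^{1/2}$. The constant $c_\delta>0$ is defined by $k_\delta=c_\delta\delta^{-1}$. Partial smoothness. For $w$ with $\partial R(w)\neq\emptyset$, $T_w=(\mathrm{span}(\partial R(w)))^\perp$, where for a closed convex set $S$, $\mathrm{span}(S)$ denotes the smallest linear subspace containing $S-x$ for all $x\in S$. $R$ is partly smooth at $w^\dagger$ (with $\partial R(w^\dagger)\ne\emptyset$) relative to a set $\mathcal{M}_{w^\dagger}\ni w^\dagger$ if: (Smoothness) $\mathcal{M}_{w^\dagger}$ is a $C^2$ manifold around $w^\dagger$ and $R|_{\mathcal{M}_{w^\dagger}}$ is $C^2$ near $w^\dagger$; (Sharpness) the tangent space of $\mathcal{M}_{w^\dagger}$ at $w^\dagger$ equals $T_{w^\dagger}$; (Continuity) the set-valued map $\partial R$ is continuous near $w^\dagger$ along $\mathcal{M}_{w^\dagger}$.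
   Formalization: Condition (iv) is required uniformly as δ→0: the limsup of α c_δ/‖X‖ must be below the distance (pointwise strictness alone makes the "moreover" part false for integer k), and "optimal" k_δ means c stays between two positive constants. *)

theory Defs
  imports "HOL-Analysis.Analysis"
begin

section \<open>Extended-real convex analysis\<close>

definition proper_fun :: "('a \<Rightarrow> ereal) \<Rightarrow> bool" where
  "proper_fun f \<longleftrightarrow> (\<forall>w. f w \<noteq> -\<infinity>) \<and> (\<exists>w. f w \<noteq> \<infinity>)"

text \<open>Only used for proper functions, so \<open>\<infinity> - \<infinity>\<close> never occurs; note that \<open>0 * \<infinity> = 0\<close> in \<open>ereal\<close>.\<close>

definition convex_fun :: "('a::real_vector \<Rightarrow> ereal) \<Rightarrow> bool" where
  "convex_fun f \<longleftrightarrow>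
     (\<forall>x y. \<forall>t\<in>{0..1}. f (t *\<^sub>R x + (1 - t) *\<^sub>R y) \<le> ereal t * f x + ereal (1 - t) * f y)"

definition lsc_fun :: "('a::topological_space \<Rightarrow> ereal) \<Rightarrow> bool" where
  "lsc_fun f \<longleftrightarrow> (\<forall>w. f w \<le> Liminf (at w) f)"

text \<open>For a proper \<open>f\<close> the subdifferential is automatically empty where \<open>f = \<infinity>\<close>.\<close>

definition subdiff :: "('a::real_inner \<Rightarrow> ereal) \<Rightarrow> 'a \<Rightarrow> 'a set" where
  "subdiff f w = {z. \<forall>u. f w + ereal (z \<bullet> (u - w)) \<le> f u}"

definition conjugate :: "('a::real_inner \<Rightarrow> ereal) \<Rightarrow> 'a \<Rightarrow> ereal" where
  "conjugate f z = (SUP w. ereal (z \<bullet> w) - f w)"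

text \<open>A choice of minimizer; it exists and is unique if \<open>R\<close> is proper, convex and lower
  semicontinuous on a Euclidean space and \<open>\<gamma> > 0\<close>.\<close>

definition prox :: "real \<Rightarrow> ('a::real_normed_vector \<Rightarrow> ereal) \<Rightarrow> 'a \<Rightarrow> 'a" where
  "prox \<gamma> R w = arg_min (\<lambda>u. R u + ereal (1 / (2 * \<gamma>) * (norm (u - w))\<^sup>2)) (\<lambda>_. True)"

definition reg_fun :: "('a::real_normed_vector \<Rightarrow> ereal) \<Rightarrow> real \<Rightarrow> 'a \<Rightarrow> ereal" where
  "reg_fun R \<alpha> w = R w + ereal (\<alpha> / 2 * (norm w)\<^sup>2)"

text \<open>Unlike \<^const>\<open>infdist\<close>, the distance to the empty set is \<open>\<infinity>\<close>.\<close>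

definition set_edist :: "'a::metric_space \<Rightarrow> 'a set \<Rightarrow> ereal" where
  "set_edist x S = (INF y\<in>S. ereal (dist x y))"

section \<open>Partial smoothness\<close>

definition C2_on :: "('a::real_normed_vector \<Rightarrow> 'b::real_normed_vector) \<Rightarrow> 'a set \<Rightarrow> bool" where
  "C2_on f U \<longleftrightarrow>
     (\<exists>(f' :: 'a \<Rightarrow> 'a \<Rightarrow>\<^sub>L 'b) (f'' :: 'a \<Rightarrow> 'a \<Rightarrow>\<^sub>L 'a \<Rightarrow>\<^sub>L 'b).
        (\<forall>x\<in>U. (f has_derivative blinfun_apply (f' x)) (at x)) \<and>
        (\<forall>x\<in>U. (f' has_derivative blinfun_apply (f'' x)) (at x)) \<and>
        continuous_on U f'')"

text \<open>Near \<open>x\<close>, the set is the zero set of a \<open>C\<^sup>2\<close> map with surjective derivative. The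
  codomain is a linear subspace \<open>N\<close> of the ambient space (of dimension the codimension of the
  manifold), which avoids a separate dimension parameter.\<close>

definition C2_manifold_around :: "'a::euclidean_space set \<Rightarrow> 'a \<Rightarrow> bool" where
  "C2_manifold_around M x \<longleftrightarrow>
     (\<exists>U N (F :: 'a \<Rightarrow> 'a). open U \<and> x \<in> U \<and> x \<in> M \<and> subspace N \<and>
        C2_on F U \<and> F ` U \<subseteq> N \<and> (\<forall>u\<in>U. range (frechet_derivative F (at u)) = N) \<and>
        M \<inter> U = {u \<in> U. F u = 0})"

text \<open>Velocities at \<open>x\<close> of \<open>C\<^sup>1\<close> curves in \<open>M\<close> through \<open>x\<close>.\<close>

definition tangent_space :: "'a::real_normed_vector set \<Rightarrow> 'a \<Rightarrow> 'a set" where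
  "tangent_space M x =
     {d. \<exists>e>0. \<exists>(g :: real \<Rightarrow> 'a) g'. g ` {-e<..<e} \<subseteq> M \<and> g 0 = x \<and> g' 0 = d \<and>
          (\<forall>t\<in>{-e<..<e}. (g has_vector_derivative g' t) (at t)) \<and>
          continuous_on {-e<..<e} g'}"

text \<open>The smallest subspace containing \<open>S - x\<close> for all \<open>x \<in> S\<close> (not the linear hull of \<open>S\<close>).\<close>

definition parallel_space :: "'a::real_vector set \<Rightarrow> 'a set" where
  "parallel_space S = span (\<Union>x\<in>S. (\<lambda>s. s - x) ` S)"

definition model_space :: "('a::real_inner \<Rightarrow> ereal) \<Rightarrow> 'a \<Rightarrow> 'a set" where
  "model_space R w = orthogonal_comp (parallel_space (subdiff R w))"

text \<open>Continuity relative to \<open>M\<close> of a set-valued map in the Painleve-Kuratowski sense: inner and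
  outer semicontinuity.\<close>

definition setmap_continuous_within ::
    "('a::topological_space \<Rightarrow> 'b::metric_space set) \<Rightarrow> 'a \<Rightarrow> 'a set \<Rightarrow> bool" where
  "setmap_continuous_within S w M \<longleftrightarrow>
     (\<forall>z\<in>S w. \<forall>e>0. \<forall>\<^sub>F u in at w within M. \<exists>z'\<in>S u. dist z' z < e) \<and>
     (\<forall>z. (\<forall>e>0. \<exists>\<^sub>F u in at w within M. \<exists>z'\<in>S u. dist z' z < e) \<longrightarrow> z \<in> S w)"

text \<open>A function on \<open>M\<close> is \<open>C\<^sup>2\<close> near \<open>x\<close> if it agrees on \<open>M\<close> near \<open>x\<close> with a real-valued
  \<open>C\<^sup>2\<close> function on an open set of the ambient space.\<close>

definition partly_smooth :: "('a::euclidean_space \<Rightarrow> ereal) \<Rightarrow> 'a \<Rightarrow> 'a set \<Rightarrow> bool" where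
  "partly_smooth R x M \<longleftrightarrow>
     subdiff R x \<noteq> {} \<and> x \<in> M \<and>
     C2_manifold_around M x \<and>
     (\<exists>U (g :: 'a \<Rightarrow> real). open U \<and> x \<in> U \<and> C2_on g U \<and> (\<forall>w\<in>M \<inter> U. R w = ereal (g w))) \<and>
     tangent_space M x = model_space R x \<and>
     (\<exists>U. open U \<and> x \<in> U \<and> (\<forall>w\<in>M \<inter> U. setmap_continuous_within (subdiff R) w M))"

section \<open>Dual gradient descent\<close>

definition op_norm :: "real^'p^'n \<Rightarrow> real" where
  "op_norm X = onorm (\<lambda>w. X *v w)"

definition dual_objective ::
    "(real^'p \<Rightarrow> ereal) \<Rightarrow> real \<Rightarrow> real^'p^'n \<Rightarrow> real^'n \<Rightarrow> real^'n \<Rightarrow> ereal" where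
  "dual_objective R \<alpha> X y v = conjugate (reg_fun R \<alpha>) (- (transpose X *v v)) + ereal (y \<bullet> v)"

definition primal_of_dual :: "(real^'p \<Rightarrow> ereal) \<Rightarrow> real \<Rightarrow> real^'p^'n \<Rightarrow> real^'n \<Rightarrow> real^'p" where
  "primal_of_dual R \<alpha> X v = prox (1 / \<alpha>) R ((1 / \<alpha>) *\<^sub>R (- (transpose X *v v)))"

primrec dgd_v ::
    "(real^'p \<Rightarrow> ereal) \<Rightarrow> real \<Rightarrow> real^'p^'n \<Rightarrow> real^'n \<Rightarrow> nat \<Rightarrow> real^'n" where
  "dgd_v R \<alpha> X y 0 = 0"
| "dgd_v R \<alpha> X y (Suc k) = dgd_v R \<alpha> X y k +
     (\<alpha> / (op_norm X)\<^sup>2) *\<^sub>R (X *v primal_of_dual R \<alpha> X (dgd_v R \<alpha> X y k) - y)"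

definition dgd_w ::
    "(real^'p \<Rightarrow> ereal) \<Rightarrow> real \<Rightarrow> real^'p^'n \<Rightarrow> real^'n \<Rightarrow> nat \<Rightarrow> real^'p" where
  "dgd_w R \<alpha> X y k = primal_of_dual R \<alpha> X (dgd_v R \<alpha> X y k)"

text \<open>The stability estimate bounds the error at any \<open>k \<delta>\<close> between \<open>\<lfloor>c / \<delta>\<rfloor>\<close> and
  \<open>2 \<lfloor>c / \<delta>\<rfloor>\<close>, where \<open>c \<ge> \<delta>\<close>, by \<open>(a (sqrt c + 1) + b / sqrt c) sqrt \<delta>\<close>. The stopping time is
  (order-)optimal, i.e. has error \<open>O(sqrt \<delta>)\<close>, when \<open>c\<close> is of constant order: either a constant,
  or depending on \<open>\<delta>\<close> but bounded away from \<open>0\<close> and \<open>\<infinity>\<close>. Without the lower bound the choice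
  \<open>c = \<delta>\<close>, \<open>k \<delta> = 1\<close> would be allowed.\<close>

definition optimal_stopping_time :: "(real \<Rightarrow> nat) \<Rightarrow> bool" where
  "optimal_stopping_time k \<longleftrightarrow>
     (\<exists>(c :: real \<Rightarrow> real) c_min c_max. 0 < c_min \<and>
        (\<forall>\<delta>\<in>{0<..<1}. c_min \<le> c \<delta> \<and> c \<delta> \<le> c_max) \<and>
        (\<forall>\<delta>\<in>{0<..<1}. \<delta> \<le> c \<delta> \<longrightarrow> k \<delta> \<in> {nat \<lfloor>c \<delta> / \<delta>\<rfloor>..2 * nat \<lfloor>c \<delta> / \<delta>\<rfloor>}))"

text \<open>The \<open>c\<^sub>\<delta>\<close> with \<open>k \<delta> = c\<^sub>\<delta> / \<delta>\<close>.\<close>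

definition stopping_const :: "(real \<Rightarrow> nat) \<Rightarrow> real \<Rightarrow> real" where
  "stopping_const k \<delta> = real (k \<delta>) * \<delta>"

definition active_region :: "(real^'p \<Rightarrow> ereal) \<Rightarrow> real \<Rightarrow> (real^'p) set \<Rightarrow> real^'p \<Rightarrow> real \<Rightarrow> (real^'p) set" where
  "active_region R \<alpha> M x \<epsilon> = (\<Union>w\<in>M \<inter> ball x \<epsilon>. (\<lambda>z. w + z) ` subdiff (reg_fun R \<alpha>) w)"

text \<open>The requirement \<open>\<alpha> c\<^sub>\<delta> / \<parallel>X\<parallel> < D\<close> on the fixed constant \<open>\<alpha>\<close>, uniformly as the noise level
  tends to \<open>0\<close>. Equivalently, some \<open>D' < D\<close> satisfies \<open>\<alpha> c\<^sub>\<delta> / \<parallel>X\<parallel> \<le> D'\<close> for all small \<open>\<delta>\<close>; if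
  \<open>c\<^sub>\<delta>\<close> does not depend on \<open>\<delta>\<close> this is the plain inequality. Requiring only the strict inequality
  for each \<open>\<delta>\<close> would let \<open>\<alpha> c\<^sub>\<delta> / \<parallel>X\<parallel>\<close> approach \<open>D\<close>, and then the identification
  of the manifold on a whole interval around \<open>k \<delta>\<close> fails: take \<open>n = p = 1\<close>, \<open>X = 1\<close>,
  \<open>R = abs\<close>, \<open>\<alpha> = 1\<close>, true solution \<open>0\<close>, \<open>M = {0}\<close> (so \<open>D = 1\<close>), observation \<open>-\<delta>\<close>, and \<open>k \<delta>\<close>
  the largest integer below \<open>1 / \<delta>\<close>.\<close>

definition noise_margin :: "real \<Rightarrow> real^'p^'n \<Rightarrow> (real \<Rightarrow> nat) \<Rightarrow> ereal \<Rightarrow> bool" where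
  "noise_margin \<alpha> X k D \<longleftrightarrow>
     Limsup (at_right 0) (\<lambda>\<delta>. ereal (\<alpha> * stopping_const k \<delta> / op_norm X)) < D"

end

theory Submission
  imports Defs
begin

text \<open>The noiseless step \<open>T\<close> is firmly nonexpansive with fixed point \<open>v\<^sup>\<dagger>\<close>, and a noisy step is
  \<open>T\<close> plus a constant vector of norm at most \<open>\<gamma> \<delta>\<close>. So after \<open>j\<close> steps the two dual sequences are at
  distance at most \<open>j \<gamma> \<delta>\<close>, which puts \<open>z\<^sub>\<delta>\<close> within \<open>\<alpha> j \<delta> / \<parallel>X\<parallel>\<close> of \<open>z\<^sub>0\<close>.
  Summing the firm nonexpansiveness inequality bounds the average squared residual, hence the
  last one, as the step lengths are nonincreasing; the residual controls the primal error by strong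
  monotonicity, so \<open>w\<^sub>\<delta> \<rightarrow> w\<^sup>\<dagger>\<close> when \<open>j \<rightarrow> \<infinity>\<close> and \<open>j \<delta>\<close> stays bounded. (The rate is worse than that of
  the stability estimate, but only convergence is used.)
  Thus \<open>w\<^sub>\<delta> + z\<^sub>\<delta>\<close> is closer to \<open>w\<^sup>\<dagger> + z\<^sup>\<dagger>\<close> than the boundary of the active region, so it lies in the
  region, and injectivity of the resolvent decomposition \<open>w + z\<close>, \<open>z \<in> \<partial>R\<^sub>\<alpha>(w)\<close>, gives \<open>w\<^sub>\<delta> \<in> M\<close>.
  The margin absorbs one step, so \<open>k \<delta> - 1\<close> and \<open>k \<delta> + 1\<close> bound a suitable interval.\<close>

section \<open>Subgradients of the regularized function\<close>

lemma subdiff_finite: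
  assumes "proper_fun R" "z \<in> subdiff R p"
  shows "\<exists>r. R p = ereal r"
proof -
  obtain u where u: "R u \<noteq> \<infinity>" using assms by (auto simp: proper_fun_def)
  have "R p + ereal (z \<bullet> (u - p)) \<le> R u" using assms by (auto simp: subdiff_def)
  with u have "R p \<noteq> \<infinity>" by auto
  moreover have "R p \<noteq> -\<infinity>" using assms by (auto simp: proper_fun_def)
  ultimately show ?thesis by (cases "R p") auto
qed

text \<open>The subgradient inequality is tested on the segment from \<open>p\<close> to
  \<open>u\<close>. There the quadratic term is its linearization at \<open>p\<close> plus a
  remainder of order t^2, so convexity of \<open>R\<close> and division by t leave an error of order
  t, which vanishes as t decreases to 0.\<close>

lemma subdiff_reg_fun_imp:
  assumes R: "proper_fun R" "convex_fun R" and z: "z \<in> subdiff (reg_fun R \<alpha>) p"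
  shows "z - \<alpha> *\<^sub>R p \<in> subdiff R p"
  unfolding subdiff_def
proof (intro CollectI allI)
  fix u
  have "proper_fun (reg_fun R \<alpha>)"
    using R(1) by (auto simp: proper_fun_def reg_fun_def)
  then obtain r' where "reg_fun R \<alpha> p = ereal r'" using subdiff_finite z by blast
  then obtain rp where rp: "R p = ereal rp" by (cases "R p") (auto simp: reg_fun_def)
  show "R p + ereal ((z - \<alpha> *\<^sub>R p) \<bullet> (u - p)) \<le> R u"
  proof (cases "R u")
    case (real ru)
    have bound: "rp - ru + (z - \<alpha> *\<^sub>R p) \<bullet> (u - p) \<le> t * (\<alpha> / 2 * (norm (u - p))\<^sup>2)"
      if t: "0 < t" "t < 1" for t
    proof -
      let ?q = "t *\<^sub>R u + (1 - t) *\<^sub>R p"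
      have q: "?q = p + t *\<^sub>R (u - p)" by (simp add: algebra_simps)
      have "R ?q \<le> ereal t * R u + ereal (1 - t) * R p"
        using R(2) t by (auto simp: convex_fun_def)
      then have le: "R ?q \<le> ereal (t * ru + (1 - t) * rp)" by (simp add: real rp)
      moreover have "R ?q \<noteq> -\<infinity>" using R(1) by (auto simp: proper_fun_def)
      ultimately obtain rq where rq: "R ?q = ereal rq" by (cases "R ?q") auto
      have "reg_fun R \<alpha> p + ereal (z \<bullet> (?q - p)) \<le> reg_fun R \<alpha> ?q"
        using z by (auto simp: subdiff_def)
      then have "rp + \<alpha> / 2 * (norm p)\<^sup>2 + z \<bullet> (?q - p) \<le> rq + \<alpha> / 2 * (norm ?q)\<^sup>2"
        by (simp add: reg_fun_def rp rq)
      moreover have "z \<bullet> (?q - p) = t * (z \<bullet> (u - p))" by (simp add: q)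
      moreover have "\<alpha> / 2 * (norm ?q)\<^sup>2
          = \<alpha> / 2 * (norm p)\<^sup>2 + t * (\<alpha> * (p \<bullet> (u - p))) + t * (t * (\<alpha> / 2 * (norm (u - p))\<^sup>2))"
      proof -
        have "(norm ?q)\<^sup>2 = (norm p)\<^sup>2 + 2 * t * (p \<bullet> (u - p)) + t\<^sup>2 * (norm (u - p))\<^sup>2"
          unfolding q power2_norm_eq_inner
          by (simp add: inner_add_left inner_add_right inner_commute power2_eq_square)
        then show ?thesis by (simp only:) (simp add: field_simps power2_eq_square)
      qed
      ultimately have "rp + t * (z \<bullet> (u - p))
          \<le> rq + t * (\<alpha> * (p \<bullet> (u - p))) + t * (t * (\<alpha> / 2 * (norm (u - p))\<^sup>2))"
        by linarith
      moreover have "rq \<le> t * ru + (1 - t) * rp" using le rq by simp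
      moreover have "t * (rp - ru + (z - \<alpha> *\<^sub>R p) \<bullet> (u - p))
          = t * rp - t * ru + t * (z \<bullet> (u - p)) - t * (\<alpha> * (p \<bullet> (u - p)))"
        by (simp only: inner_diff_left inner_scaleR_left distrib_left right_diff_distrib)
      ultimately have "t * (rp - ru + (z - \<alpha> *\<^sub>R p) \<bullet> (u - p)) \<le> t * (t * (\<alpha> / 2 * (norm (u - p))\<^sup>2))"
        by (simp only: left_diff_distrib mult_1_left)
      then show ?thesis using t by simp
    qed
    have "((\<lambda>t. t * (\<alpha> / 2 * (norm (u - p))\<^sup>2)) \<longlongrightarrow> 0) (at_right 0)"
      by (auto intro!: tendsto_eq_intros)
    moreover have "\<forall>\<^sub>F t in at_right (0::real).
        rp - ru + (z - \<alpha> *\<^sub>R p) \<bullet> (u - p) \<le> t * (\<alpha> / 2 * (norm (u - p))\<^sup>2)"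
      unfolding eventually_at_right_field using bound by (intro exI[of _ 1]) auto
    ultimately have "rp - ru + (z - \<alpha> *\<^sub>R p) \<bullet> (u - p) \<le> 0"
      by (rule tendsto_lowerbound) simp
    then show ?thesis by (simp add: real rp)
  qed (use R(1) in \<open>auto simp: proper_fun_def\<close>)
qed

text \<open>Adding the subgradient inequalities of \<open>R\<close> at the two points gives
  monotonicity of its subdifferential; the shifts by \<open>\<alpha> *\<^sub>R p\<close> and
  \<open>\<alpha> *\<^sub>R p'\<close> contribute the quadratic term.\<close>

lemma subdiff_reg_fun_strongly_monotone:
  assumes R: "proper_fun R" "convex_fun R"
    and z: "z \<in> subdiff (reg_fun R \<alpha>) p" "z' \<in> subdiff (reg_fun R \<alpha>) p'"
  shows "\<alpha> * (norm (p - p'))\<^sup>2 \<le> (z - z') \<bullet> (p - p')"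
proof -
  have s: "z - \<alpha> *\<^sub>R p \<in> subdiff R p" "z' - \<alpha> *\<^sub>R p' \<in> subdiff R p'"
    using subdiff_reg_fun_imp[OF R] z by auto
  obtain r r' where "R p = ereal r" "R p' = ereal r'"
    using s subdiff_finite R by metis
  moreover have "R p + ereal ((z - \<alpha> *\<^sub>R p) \<bullet> (p' - p)) \<le> R p'"
    "R p' + ereal ((z' - \<alpha> *\<^sub>R p') \<bullet> (p - p')) \<le> R p"
    using s by (auto simp: subdiff_def)
  ultimately have "(z - \<alpha> *\<^sub>R p) \<bullet> (p' - p) + (z' - \<alpha> *\<^sub>R p') \<bullet> (p - p') \<le> 0" by simp
  then show ?thesis
    unfolding power2_norm_eq_inner by (simp add: algebra_simps inner_commute)
qed

section \<open>Existence and optimality condition of the proximal point\<close>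

lemma lsc_eventually_greater:
  assumes "lsc_fun f" "c < f x" "(s \<longlongrightarrow> x) F"
  shows "\<forall>\<^sub>F n in F. c < f (s n)"
proof -
  have "f x \<le> Liminf (at x) f" using assms by (auto simp: lsc_fun_def)
  then have "\<forall>\<^sub>F u in at x. c < f u" using assms by (auto simp: le_Liminf_iff)
  \<comment> \<open>The lower limit ignores \<open>x\<close> itself, which \<open>s\<close> may hit;
    \<open>c < f x\<close> fills in that point.\<close>
  then have "\<forall>\<^sub>F u in nhds x. c < f u"
    using assms(2) unfolding eventually_nhds_conv_at by blast
  then show ?thesis using assms(3) unfolding filterlim_iff by blast
qed

text \<open>Direct method: the subgradient \<open>g\<close> gives an affine minorant of
  \<open>R\<close>, so the objective grows quadratically, a minimizing sequence is bounded, and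
  lower semicontinuity makes a cluster point a minimizer. This gives meaning to the choice made by
  \<open>arg_min\<close> in \<open>prox\<close>.\<close>

lemma prox_exists:
  fixes R :: "'a::euclidean_space \<Rightarrow> ereal"
  assumes R: "proper_fun R" "lsc_fun R" and g: "g \<in> subdiff R p" and \<gamma>: "0 < \<gamma>"
  shows "\<exists>x. is_arg_min (\<lambda>u. R u + ereal (1 / (2 * \<gamma>) * (norm (u - w))\<^sup>2)) (\<lambda>_. True) x"
proof -
  let ?q = "\<lambda>u. 1 / (2 * \<gamma>) * (norm (u - w))\<^sup>2"
  let ?h = "\<lambda>u. R u + ereal (?q u)"
  define m where "m = (INF u. ?h u)"
  obtain rp where rp: "R p = ereal rp" using subdiff_finite R(1) g by blast
  have lower: "ereal (rp + g \<bullet> (u - p)) \<le> R u" for u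
    using g by (auto simp: subdiff_def rp)
  \<comment> \<open>Half of the quadratic term absorbs the linear term of the minorant by completing
    the square, at the cost of \<open>\<gamma> * (norm g)\<^sup>2\<close>; the other half gives the
    growth.\<close>
  define C where "C = rp + g \<bullet> (w - p) - \<gamma> * (norm g)\<^sup>2"
  have coercive: "ereal (C + 1 / (4 * \<gamma>) * (norm (u - w))\<^sup>2) \<le> ?h u" for u
  proof -
    have "0 \<le> 1 / (4 * \<gamma>) * (norm ((u - w) + (2 * \<gamma>) *\<^sub>R g))\<^sup>2" using \<gamma> by simp
    also have "\<dots> = 1 / (4 * \<gamma>) * (norm (u - w))\<^sup>2 + g \<bullet> (u - w) + \<gamma> * (norm g)\<^sup>2"
    proof -
      have "(norm ((u - w) + (2 * \<gamma>) *\<^sub>R g))\<^sup>2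
          = (norm (u - w))\<^sup>2 + 4 * \<gamma> * (g \<bullet> (u - w)) + 4 * \<gamma>\<^sup>2 * (norm g)\<^sup>2"
        unfolding power2_norm_eq_inner
        by (simp add: inner_add_left inner_add_right inner_commute power2_eq_square)
      then show ?thesis using \<gamma> by (simp add: field_simps power2_eq_square)
    qed
    finally have sq: "0 \<le> 1 / (4 * \<gamma>) * (norm (u - w))\<^sup>2 + g \<bullet> (u - w) + \<gamma> * (norm g)\<^sup>2" .
    have "C + 1 / (4 * \<gamma>) * (norm (u - w))\<^sup>2 \<le> rp + g \<bullet> (u - p) + ?q u"
    proof -
      have "?q u = 1 / (4 * \<gamma>) * (norm (u - w))\<^sup>2 + 1 / (4 * \<gamma>) * (norm (u - w))\<^sup>2"
        using \<gamma> by (simp add: field_simps)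
      moreover have "g \<bullet> (u - p) = g \<bullet> (u - w) + g \<bullet> (w - p)" by (simp add: inner_diff_right)
      ultimately show ?thesis using sq unfolding C_def by linarith
    qed
    then have "ereal (C + 1 / (4 * \<gamma>) * (norm (u - w))\<^sup>2) \<le> ereal (rp + g \<bullet> (u - p)) + ereal (?q u)"
      by simp
    also have "\<dots> \<le> ?h u" by (intro add_right_mono lower)
    finally show ?thesis .
  qed
  have "ereal C \<le> m"
    unfolding m_def
  proof (rule INF_greatest)
    fix u
    have "ereal C \<le> ereal (C + 1 / (4 * \<gamma>) * (norm (u - w))\<^sup>2)" using \<gamma> by simp
    then show "ereal C \<le> ?h u" using coercive order_trans by blast
  qed
  moreover have "m \<le> ?h p" unfolding m_def by (rule INF_lower) simp
  ultimately obtain mr where mr: "m = ereal mr" by (cases m) (auto simp: rp)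
  have "\<exists>u. ?h u < m + ereal (inverse (Suc n))" for n
  proof -
    have "m < m + ereal (inverse (Suc n))" by (simp add: mr)
    then show ?thesis unfolding m_def INF_less_iff by auto
  qed
  then obtain s where s: "\<And>n. ?h (s n) < m + ereal (inverse (Suc n))" by metis
  \<comment> \<open>Since t \<le> t^2 + 1 for every real t, the bound on the squared norm bounds the
    norm without a square root.\<close>
  have "norm (s n - w) \<le> 4 * \<gamma> * (mr + 1 - C) + 1" for n
  proof -
    have "inverse (real (Suc n)) \<le> 1" by (simp add: inverse_eq_divide)
    moreover have "C + 1 / (4 * \<gamma>) * (norm (s n - w))\<^sup>2 < mr + inverse (Suc n)"
      using le_less_trans[OF coercive s] by (simp add: mr)
    ultimately have "1 / (4 * \<gamma>) * (norm (s n - w))\<^sup>2 \<le> mr + 1 - C" by linarith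
    then have *: "(norm (s n - w))\<^sup>2 \<le> 4 * \<gamma> * (mr + 1 - C)"
      using \<gamma> by (simp add: field_simps)
    have "0 \<le> (norm (s n - w) - 1)\<^sup>2 + (norm (s n - w))\<^sup>2 + 1" by simp
    moreover have "0 \<le> (2 * norm (s n - w) - 1)\<^sup>2" by simp
    ultimately show ?thesis using * by (simp add: power2_eq_square algebra_simps)
  qed
  then have "s n \<in> cball w (4 * \<gamma> * (mr + 1 - C) + 1)" for n
    by (simp add: dist_norm norm_minus_commute)
  then obtain x \<phi> where \<phi>: "strict_mono (\<phi> :: nat \<Rightarrow> nat)" "(s \<circ> \<phi>) \<longlonglongrightarrow> x"
    using compact_cball[unfolded compact_def] by metis
  have q_lim: "(\<lambda>n. ?q (s (\<phi> n))) \<longlonglongrightarrow> ?q x"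
    using \<phi>(2) unfolding comp_def by (intro tendsto_intros)
  have inv_lim: "(\<lambda>n. inverse (real (Suc (\<phi> n)))) \<longlonglongrightarrow> 0"
    using LIMSEQ_subseq_LIMSEQ[OF LIMSEQ_inverse_real_of_nat \<phi>(1)] by (simp add: comp_def)
  \<comment> \<open>Otherwise some real \<open>b\<close> above \<open>mr - ?q x\<close> lies below
    \<open>R\<close> eventually along the subsequence, and the limit of the objective values forces
    \<open>b + ?q x \<le> mr\<close>.\<close>
  have "R x \<le> ereal (mr - ?q x)"
  proof (rule ccontr)
    assume "\<not> R x \<le> ereal (mr - ?q x)"
    then have "ereal (mr - ?q x) < R x" by (rule not_le_imp_less)
    from ereal_dense2[OF this] obtain b where b: "ereal (mr - ?q x) < ereal b" "ereal b < R x"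
      by blast
    have "\<forall>\<^sub>F n in sequentially. ereal b < R (s (\<phi> n))"
      using lsc_eventually_greater[OF R(2) b(2)] \<phi>(2) unfolding comp_def by blast
    then have "\<forall>\<^sub>F n in sequentially. b + ?q (s (\<phi> n)) \<le> mr + inverse (real (Suc (\<phi> n)))"
    proof (rule eventually_mono)
      fix n assume "ereal b < R (s (\<phi> n))"
      then have "ereal b + ereal (?q (s (\<phi> n))) \<le> ?h (s (\<phi> n))"
        by (intro add_right_mono) simp
      also have "\<dots> < m + ereal (inverse (Suc (\<phi> n)))" by (rule s)
      finally show "b + ?q (s (\<phi> n)) \<le> mr + inverse (real (Suc (\<phi> n)))" by (simp add: mr)
    qed
    then have "b + ?q x \<le> mr + 0"
      by (rule tendsto_le[OF sequentially_bot tendsto_add[OF tendsto_const inv_lim]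
            tendsto_add[OF tendsto_const q_lim]])
    with b show False by simp
  qed
  then have "?h x \<le> ereal (mr - ?q x) + ereal (?q x)" by (intro add_right_mono)
  then have "?h x \<le> m" by (simp add: mr)
  moreover have "m \<le> ?h u" for u unfolding m_def by (rule INF_lower) simp
  ultimately have "?h x \<le> ?h u" for u by (rule order_trans)
  then show ?thesis by (auto simp: is_arg_min_def not_less)
qed

text \<open>Expanding the square turns the proximal objective at
  \<open>(1 / \<alpha>) *\<^sub>R z\<close> into \<open>reg_fun R \<alpha> u\<close> minus the
  linear term \<open>z \<bullet> u\<close> plus a constant, so minimality is exactly the subgradient
  inequality.\<close>

lemma prox_subdiff:
  fixes R :: "'a::euclidean_space \<Rightarrow> ereal"
  assumes R: "proper_fun R" "lsc_fun R" and g: "g \<in> subdiff R p" and \<alpha>: "0 < \<alpha>"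
  shows "z \<in> subdiff (reg_fun R \<alpha>) (prox (1 / \<alpha>) R ((1 / \<alpha>) *\<^sub>R z))"
proof -
  let ?w = "(1 / \<alpha>) *\<^sub>R z"
  define x where "x = prox (1 / \<alpha>) R ?w"
  let ?h = "\<lambda>u. R u + ereal (1 / (2 * (1 / \<alpha>)) * (norm (u - ?w))\<^sup>2)"
  have "is_arg_min ?h (\<lambda>_. True) x"
    using prox_exists[OF R g, of "1 / \<alpha>"] \<alpha>
    unfolding x_def prox_def arg_min_def by (auto intro: someI_ex)
  then have min: "?h x \<le> ?h u" for u by (auto simp: is_arg_min_def not_less)
  have sq: "1 / (2 * (1 / \<alpha>)) * (norm (u - ?w))\<^sup>2
      = \<alpha> / 2 * (norm u)\<^sup>2 - z \<bullet> u + (norm z)\<^sup>2 / (2 * \<alpha>)" for u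
    unfolding power2_norm_eq_inner using \<alpha>
    by (simp add: inner_diff_left inner_diff_right inner_commute field_simps)
  have "reg_fun R \<alpha> x + ereal (z \<bullet> (u - x)) \<le> reg_fun R \<alpha> u" for u
    using min[of u] R(1) unfolding sq
    by (cases "R x"; cases "R u") (auto simp: reg_fun_def proper_fun_def inner_diff_right)
  then show ?thesis by (simp add: subdiff_def x_def)
qed

text \<open>A segment that leaves \<open>S\<close> crosses the frontier at a point no farther from
  \<open>x\<close> than \<open>y\<close>. An empty frontier, at distance \<infinity>, is covered:
  the crossing point then cannot exist.\<close>

lemma mem_of_dist_less_frontier:
  fixes x y :: "'a::real_normed_vector"
  assumes "x \<in> S" "ereal (dist x y) < set_edist x (frontier S)"
  shows "y \<in> S"
proof (rule ccontr)
  assume "y \<notin> S"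
  then have "closed_segment x y \<inter> frontier S \<noteq> {}"
    using assms(1) by (intro connected_Int_frontier) (auto intro: ends_in_segment)
  then obtain f where f: "f \<in> closed_segment x y" "f \<in> frontier S" by auto
  then have "set_edist x (frontier S) \<le> ereal (dist x f)"
    unfolding set_edist_def by (intro INF_lower)
  also have "\<dots> \<le> ereal (dist x y)"
    using segment_bound1[OF f(1)] by (simp add: dist_norm norm_minus_commute)
  finally show False using assms(2) by simp
qed

lemma tendsto_zero_of_power2_le:
  fixes f g :: "'a \<Rightarrow> real"
  assumes "\<forall>\<^sub>F x in F. (f x)\<^sup>2 \<le> g x" "(g \<longlongrightarrow> 0) F"
  shows "(f \<longlongrightarrow> 0) F"
proof -
  have "\<forall>\<^sub>F x in F. norm ((f x)\<^sup>2) \<le> g x" using assms(1) by simp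
  then have "((\<lambda>x. (f x)\<^sup>2) \<longlongrightarrow> 0) F" using assms(2) by (rule Lim_null_comparison)
  then have "((\<lambda>x. sqrt ((f x)\<^sup>2)) \<longlongrightarrow> sqrt 0) F" by (rule tendsto_real_sqrt)
  then show ?thesis by (simp add: tendsto_rabs_zero_iff)
qed

section \<open>Perturbed iteration of a firmly nonexpansive map\<close>

text \<open>Each step adds at most \<open>norm b\<close>, as \<open>T\<close> does not expand the
  earlier difference. The sequence \<open>u\<close> is later either the noiseless one or constant at
  a fixed point.\<close>

lemma perturbed_iterates_dist:
  fixes T :: "'a::real_normed_vector \<Rightarrow> 'a"
  assumes nonexp: "\<And>u v. norm (T u - T v) \<le> norm (u - v)"
    and v: "\<And>j. v (Suc j) = T (v j) + b" and u: "\<And>j. u (Suc j) = T (u j)"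
  shows "norm (v j - u j) \<le> norm (v 0 - u 0) + real j * norm b"
proof (induction j)
  case (Suc j)
  have "norm (v (Suc j) - u (Suc j)) = norm ((T (v j) - T (u j)) + b)"
    by (simp add: u v algebra_simps)
  also have "\<dots> \<le> norm (v j - u j) + norm b"
    using norm_triangle_ineq nonexp[of "v j" "u j"] by (meson add_right_mono order_trans)
  finally show ?case using Suc by (simp add: algebra_simps)
qed simp

lemma firmly_nonexpansive_imp_nonexpansive:
  fixes T :: "'a::real_normed_vector \<Rightarrow> 'a"
  assumes firm: "\<And>u v. (norm (T u - T v))\<^sup>2 + (norm ((T u - u) - (T v - v)))\<^sup>2 \<le> (norm (u - v))\<^sup>2"
  shows "norm (T u - T v) \<le> norm (u - v)"
proof (rule power2_le_imp_le)
  show "(norm (T u - T v))\<^sup>2 \<le> (norm (u - v))\<^sup>2"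
    using firm[of u v] zero_le_power2[of "norm ((T u - u) - (T v - v))"] by linarith
qed simp

text \<open>The squared distance to \<open>p\<close> drops by the squared residual at each step, up
  to noise. Telescoping bounds the sum of the squared residuals, and since these almost decrease,
  the last one is controlled by their average.\<close>

lemma perturbed_iterates_residual:
  fixes T :: "'a::real_inner \<Rightarrow> 'a"
  assumes firm: "\<And>u v. (norm (T u - T v))\<^sup>2 + (norm ((T u - u) - (T v - v)))\<^sup>2 \<le> (norm (u - v))\<^sup>2"
    and fixed: "T p = p" and v: "\<And>j. v (Suc j) = T (v j) + b"
  shows "real N * (norm (T (v N) - v N))\<^sup>2
    \<le> 2 * (norm (v 0 - p))\<^sup>2
      + real N * norm b * (4 * norm (v 0 - p) + 4 * (real N * norm b) + 10 * norm b)"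
proof -
  define e where "e j = norm (v j - p)" for j
  define s where "s j = norm (T (v j) - v j)" for j
  define \<eta> where "\<eta> = norm b"
  have [simp]: "0 \<le> \<eta>" "0 \<le> e j" "0 \<le> s j" for j by (auto simp: \<eta>_def e_def s_def)
  note nonexp = firmly_nonexpansive_imp_nonexpansive[of T, OF firm]
  have e_bound: "e j \<le> e 0 + real j * \<eta>" for j
    using perturbed_iterates_dist[where T = T and v = v and u = "\<lambda>_. p", OF nonexp v] fixed by (simp add: e_def \<eta>_def)
  have step: "(e (Suc j))\<^sup>2 + (s j)\<^sup>2 \<le> (e j)\<^sup>2 + \<eta> * (2 * e j + \<eta>)" for j
  proof -
    have "e (Suc j) \<le> norm (T (v j) - T p) + \<eta>"
      unfolding e_def v \<eta>_def fixed
      by (metis add.commute add_diff_eq norm_triangle_ineq)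
    then have "(e (Suc j))\<^sup>2 \<le> (norm (T (v j) - T p) + \<eta>)\<^sup>2" by (intro power_mono) auto
    also have "\<dots> = (norm (T (v j) - T p))\<^sup>2 + \<eta> * (2 * norm (T (v j) - T p) + \<eta>)"
      by (simp add: power2_eq_square algebra_simps)
    also have "\<dots> \<le> ((e j)\<^sup>2 - (s j)\<^sup>2) + \<eta> * (2 * e j + \<eta>)"
      using firm[of "v j" p] nonexp[of "v j" p] fixed
      by (intro add_mono mult_left_mono) (auto simp: e_def s_def)
    finally show ?thesis by simp
  qed
  \<comment> \<open>The distance to \<open>p\<close> is bounded through the final index
    \<open>N\<close>, so that every step has the same noise term.\<close>
  have sum_bound: "(e n)\<^sup>2 + (\<Sum>j<n. (s j)\<^sup>2) \<le> (e 0)\<^sup>2 + real n * (\<eta> * (2 * (e 0 + real N * \<eta>) + \<eta>))"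
    if "n \<le> N" for n
    using that
  proof (induction n)
    case (Suc n)
    have "real n * \<eta> \<le> real N * \<eta>" using Suc.prems by (intro mult_right_mono) auto
    then have "e n \<le> e 0 + real N * \<eta>" using e_bound[of n] by linarith
    then have "\<eta> * (2 * e n + \<eta>) \<le> \<eta> * (2 * (e 0 + real N * \<eta>) + \<eta>)"
      by (intro mult_left_mono) auto
    then show ?case using Suc step[of n] by (simp add: algebra_simps)
  qed simp
  \<comment> \<open>In a difference of consecutive iterates the constant \<open>b\<close> cancels,
    so the actual step lengths do not increase, even with noise.\<close>
  have decr: "norm (v (Suc j) - v j) \<le> norm (v (Suc i) - v i)" if "i \<le> j" for i j
    using that
  proof (induction rule: dec_induct)
    case (step n)
    have "norm (v (Suc (Suc n)) - v (Suc n)) = norm (T (v (Suc n)) - T (v n))"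
      by (simp add: v)
    also have "\<dots> \<le> norm (v (Suc n) - v n)" by (rule nonexp)
    finally show ?case using step by simp
  qed simp
  \<comment> \<open>The residual \<open>s\<close> differs from the actual step only by the omitted
    \<open>b\<close>; comparing \<open>s N\<close> with \<open>s j\<close> therefore costs
    \<open>2 * \<eta>\<close>.\<close>
  have s_step: "\<bar>s j - norm (v (Suc j) - v j)\<bar> \<le> \<eta>" for j
  proof -
    have "\<bar>norm (T (v j) - v j) - norm (v (Suc j) - v j)\<bar> \<le> norm ((T (v j) - v j) - (v (Suc j) - v j))"
      by (rule norm_triangle_ineq3)
    then show ?thesis by (simp add: v s_def \<eta>_def)
  qed
  have "(s N)\<^sup>2 \<le> 2 * (s j)\<^sup>2 + 8 * \<eta>\<^sup>2" if "j < N" for j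
  proof -
    have "s N \<le> s j + 2 * \<eta>" using s_step[of N] s_step[of j] decr[of j N] that by auto
    then have "(s N)\<^sup>2 \<le> (s j + 2 * \<eta>)\<^sup>2" by (intro power_mono) auto
    also have "\<dots> \<le> 2 * (s j)\<^sup>2 + 8 * \<eta>\<^sup>2"
      using zero_le_power2[of "s j - 2 * \<eta>"] by (simp add: power2_eq_square algebra_simps)
    finally show ?thesis .
  qed
  then have "(\<Sum>j<N. (s N)\<^sup>2) \<le> (\<Sum>j<N. 2 * (s j)\<^sup>2 + 8 * \<eta>\<^sup>2)" by (intro sum_mono) auto
  then have "real N * (s N)\<^sup>2 \<le> 2 * (\<Sum>j<N. (s j)\<^sup>2) + real N * (8 * \<eta>\<^sup>2)"
    by (simp add: sum.distrib sum_distrib_left)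
  moreover have "(\<Sum>j<N. (s j)\<^sup>2) \<le> (e 0)\<^sup>2 + real N * (\<eta> * (2 * (e 0 + real N * \<eta>) + \<eta>))"
    using sum_bound[of N] zero_le_power2[of "e N"] by linarith
  \<comment> \<open>The 10 is 2 from the doubled sum bound plus the 8 from squaring the loss
    \<open>2 * \<eta>\<close>.\<close>
  ultimately have "real N * (s N)\<^sup>2 \<le> 2 * (e 0)\<^sup>2 + real N * \<eta> * (4 * e 0 + 4 * (real N * \<eta>) + 10 * \<eta>)"
    by (simp add: algebra_simps power2_eq_square)
  then show ?thesis by (simp add: e_def s_def \<eta>_def)
qed

section \<open>Dual gradient descent\<close>

lemma norm_matrix_vector_le: "norm (X *v u) \<le> op_norm X * norm u"
  unfolding op_norm_def by (simp add: onorm matrix_vector_mul_bounded_linear)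

lemma op_norm_pos: "X \<noteq> 0 \<Longrightarrow> 0 < op_norm X"
  unfolding op_norm_def
  by (subst onorm_pos_lt[OF matrix_vector_mul_bounded_linear]) (metis matrix_eq matrix_vector_mult_0)

lemma inner_transpose_mult: "(transpose X *v v) \<bullet> u = v \<bullet> (X *v (u::real^'p))"
  by (simp add: dot_lmul_matrix transpose_matrix_vector)

text \<open>The squared norm of the left side is
  \<open>v \<bullet> (X *v (transpose X *v v))\<close>; Cauchy-Schwarz and division by the norm
  finish the nonzero case.\<close>

lemma norm_transpose_mult_le: "norm (transpose X *v v) \<le> op_norm X * norm v"
  for X :: "real^'p^'n"
proof (cases "transpose X *v v = 0")
  case True
  moreover have "0 \<le> op_norm X" unfolding op_norm_def by (rule onorm_pos_le[OF matrix_vector_mul_bounded_linear])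
  ultimately show ?thesis by simp
next
  case False
  have "(norm (transpose X *v v))\<^sup>2 = v \<bullet> (X *v (transpose X *v v))"
    by (simp only: power2_norm_eq_inner inner_transpose_mult)
  also have "\<dots> \<le> norm v * norm (X *v (transpose X *v v))" by (rule norm_cauchy_schwarz)
  also have "\<dots> \<le> norm v * (op_norm X * norm (transpose X *v v))"
    by (intro mult_left_mono norm_matrix_vector_le) auto
  finally show ?thesis using False by (simp add: power2_eq_square field_simps)
qed

text \<open>\<open>source\<close> makes \<open>vd\<close> a fixed point of the noiseless step;
  \<open>subdiff_nonempty\<close> supplies the affine minorant behind the existence of proximal
  points.\<close>

locale dual_descent =
  fixes X :: "real^'p^'n" and R :: "real^'p \<Rightarrow> ereal" and \<alpha> :: real
    and wd :: "real^'p" and vd :: "real^'n"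
  assumes X_nonzero: "X \<noteq> 0"
    and R: "proper_fun R" "convex_fun R" "lsc_fun R"
    and alpha: "0 < \<alpha>"
    and subdiff_nonempty: "subdiff R wd \<noteq> {}"
    and source: "- (transpose X *v vd) \<in> subdiff (reg_fun R \<alpha>) wd"
begin

abbreviation "L \<equiv> op_norm X"
definition "\<gamma> = \<alpha> / L\<^sup>2"
abbreviation "w v \<equiv> primal_of_dual R \<alpha> X v"
definition "T v = v + \<gamma> *\<^sub>R (X *v w v - X *v wd)"

lemma L_pos: "0 < L" using op_norm_pos X_nonzero .

lemma gamma_pos: "0 < \<gamma>" unfolding \<gamma>_def using alpha L_pos by simp

lemma primal_subdiff: "- (transpose X *v v) \<in> subdiff (reg_fun R \<alpha>) (w v)"
  using prox_subdiff[OF R(1,3) _ alpha] subdiff_nonempty unfolding primal_of_dual_def by blast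

text \<open>Strong monotonicity seen from the dual side. The dual gradient at \<open>v\<close> is
  \<open>y - X *v w v\<close>, so this yields its cocoercivity.\<close>

lemma primal_monotone: "\<alpha> * (norm (w u - w v))\<^sup>2 \<le> - ((u - v) \<bullet> (X *v (w u - w v)))"
proof -
  have "\<alpha> * (norm (w u - w v))\<^sup>2 \<le> (- (transpose X *v u) - - (transpose X *v v)) \<bullet> (w u - w v)"
    by (intro subdiff_reg_fun_strongly_monotone[OF R(1,2)] primal_subdiff)
  also have "\<dots> = - ((transpose X *v (u - v)) \<bullet> (w u - w v))"
    by (simp add: matrix_vector_mult_diff_distrib inner_diff_left)
  finally show ?thesis by (simp only: inner_transpose_mult)
qed

text \<open>Two decompositions of the same vector differ by opposite amounts in their two parts,
  which strong monotonicity allows only if they agree.\<close>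

lemma primal_eqI:
  assumes "z \<in> subdiff (reg_fun R \<alpha>) p" "p + z = w v - transpose X *v v"
  shows "w v = p"
proof -
  have "\<alpha> * (norm (w v - p))\<^sup>2 \<le> (- (transpose X *v v) - z) \<bullet> (w v - p)"
    by (intro subdiff_reg_fun_strongly_monotone[OF R(1,2)] primal_subdiff assms)
  also have "- (transpose X *v v) - z = - (w v - p)" using assms(2) by (simp add: algebra_simps)
  also have "\<dots> \<bullet> (w v - p) \<le> 0" by (simp only: inner_minus_left) simp
  finally show ?thesis using alpha by (simp add: mult_le_0_iff)
qed

lemma primal_vd: "w vd = wd"
proof -
  have "\<alpha> * (norm (w vd - wd))\<^sup>2 \<le> (- (transpose X *v vd) - - (transpose X *v vd)) \<bullet> (w vd - wd)"
    by (intro subdiff_reg_fun_strongly_monotone[OF R(1,2)] primal_subdiff source)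
  then show ?thesis using alpha by (simp add: mult_le_0_iff)
qed

lemma T_fixed: "T vd = vd" by (simp add: T_def primal_vd)

text \<open>The step size is chosen so that \<open>\<gamma> * L\<^sup>2 = \<alpha>\<close>:
  cocoercivity then dominates the quadratic terms of both squares.\<close>

lemma T_firm: "(norm (T u - T v))\<^sup>2 + (norm ((T u - u) - (T v - v)))\<^sup>2 \<le> (norm (u - v))\<^sup>2"
proof -
  let ?d = "w u - w v"
  have r: "(T u - u) - (T v - v) = \<gamma> *\<^sub>R (X *v ?d)"
    by (simp add: T_def matrix_vector_mult_diff_distrib algebra_simps)
  then have t: "T u - T v = (u - v) + \<gamma> *\<^sub>R (X *v ?d)" by (simp add: algebra_simps)
  have "\<gamma> * (norm (X *v ?d))\<^sup>2 \<le> \<gamma> * (L * norm ?d)\<^sup>2"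
    using gamma_pos by (intro mult_left_mono power_mono norm_matrix_vector_le) auto
  also have "\<dots> = \<alpha> * (norm ?d)\<^sup>2" using L_pos by (simp add: \<gamma>_def power_mult_distrib)
  also have "\<dots> \<le> - ((u - v) \<bullet> (X *v ?d))" by (rule primal_monotone)
  \<comment> \<open>Expanding the two squares leaves the cross term with factor
    \<open>2 * \<gamma>\<close> and the squared norm of \<open>X *v ?d\<close> with factor
    \<open>2 * \<gamma>\<^sup>2\<close>.\<close>
  finally have "2 * \<gamma> * (\<gamma> * (norm (X *v ?d))\<^sup>2) \<le> 2 * \<gamma> * - ((u - v) \<bullet> (X *v ?d))"
    using gamma_pos by (intro mult_left_mono) auto
  then show ?thesis
    unfolding r t power2_norm_eq_inner
    by (simp add: inner_add_left inner_add_right inner_commute algebra_simps)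
qed

lemmas T_nonexpansive = firmly_nonexpansive_imp_nonexpansive[of T, OF T_firm]

text \<open>The observation enters a step additively, so the noise is one constant vector, the same
  at every index.\<close>

lemma dgd_Suc: "dgd_v R \<alpha> X y (Suc j) = T (dgd_v R \<alpha> X y j) + \<gamma> *\<^sub>R (X *v wd - y)"
  by (simp add: T_def \<gamma>_def algebra_simps)

lemma dgd_noiseless_Suc: "dgd_v R \<alpha> X (X *v wd) (Suc j) = T (dgd_v R \<alpha> X (X *v wd) j)"
  using dgd_Suc[of "X *v wd"] by simp

text \<open>The residual \<open>T v - v\<close> is \<gamma> times \<open>X *v (w v - wd)\<close>, so
  monotonicity against \<open>vd\<close> and Cauchy-Schwarz suffice.\<close>

lemma primal_error_le_residual:
  "\<alpha> * (norm (w v - wd))\<^sup>2 \<le> norm (v - vd) * norm (T v - v) / \<gamma>"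
proof -
  have "\<alpha> * (norm (w v - wd))\<^sup>2 \<le> - ((v - vd) \<bullet> (X *v (w v - wd)))"
    using primal_monotone[of v vd] by (simp add: primal_vd)
  also have "\<dots> \<le> norm (v - vd) * norm (X *v (w v - wd))"
    using Cauchy_Schwarz_ineq2[of "v - vd" "X *v (w v - wd)"] by linarith
  also have "X *v (w v - wd) = (1 / \<gamma>) *\<^sub>R (T v - v)"
    using gamma_pos by (simp add: T_def matrix_vector_mult_diff_distrib)
  also have "norm (v - vd) * norm ((1 / \<gamma>) *\<^sub>R (T v - v)) = norm (v - vd) * norm (T v - v) / \<gamma>"
    using gamma_pos by simp
  finally show ?thesis .
qed

section \<open>Primal convergence and identification along a noise-dependent index\<close>

lemma dgd_w_tendsto:
  assumes noise: "\<And>\<delta>. 0 < \<delta> \<Longrightarrow> \<delta> < 1 \<Longrightarrow> norm (y \<delta> - X *v wd) \<le> \<delta>"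
    and N: "filterlim N at_top (at_right 0)"
    and C: "\<forall>\<^sub>F \<delta> in at_right 0. real (N \<delta>) * \<delta> \<le> C"
  shows "((\<lambda>\<delta>. dgd_w R \<alpha> X (y \<delta>) (N \<delta>)) \<longlongrightarrow> wd) (at_right 0)"
proof -
  define v where "v \<delta> = dgd_v R \<alpha> X (y \<delta>) (N \<delta>)" for \<delta>
  define s where "s \<delta> = norm (T (v \<delta>) - v \<delta>)" for \<delta>
  define E where "E = norm vd"
  have small: "\<forall>\<^sub>F \<delta> in at_right 0. 0 < \<delta> \<and> \<delta> < (1::real)"
    by (auto simp: eventually_at_right_field intro: exI[of _ 1])
  have Npos: "\<forall>\<^sub>F \<delta> in at_right 0. 1 \<le> N \<delta>" using N by (simp add: filterlim_at_top)
  have Nreal: "filterlim (\<lambda>\<delta>. real (N \<delta>)) at_top (at_right 0)"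
    using filterlim_compose[OF filterlim_real_sequentially N] .
  have noise': "norm (\<gamma> *\<^sub>R (X *v wd - y \<delta>)) \<le> \<gamma> * \<delta>" if "0 < \<delta>" "\<delta> < 1" for \<delta>
    using noise[OF that] gamma_pos by (simp add: norm_minus_commute)
  \<comment> \<open>The residual estimate divided by \<open>N \<delta>\<close>, with the noise per
    step bounded by \<open>\<gamma> * \<delta>\<close> and the accumulated noise by
    \<open>\<gamma> * C\<close>. The iteration starts at 0, so the initial distance to
    \<open>vd\<close> is \<open>E\<close>.\<close>
  define B where "B \<delta> = 2 * E\<^sup>2 / real (N \<delta>) + \<gamma> * \<delta> * (4 * E + 4 * (\<gamma> * C) + 10 * (\<gamma> * \<delta>))" for \<delta>
  have "\<forall>\<^sub>F \<delta> in at_right 0. (s \<delta>)\<^sup>2 \<le> B \<delta>"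
    using small Npos C
  proof eventually_elim
    case (elim \<delta>)
    define \<eta> where "\<eta> = norm (\<gamma> *\<^sub>R (X *v wd - y \<delta>))"
    have \<eta>: "0 \<le> \<eta>" "\<eta> \<le> \<gamma> * \<delta>" using noise' elim by (auto simp: \<eta>_def)
    have "real (N \<delta>) * \<eta> \<le> real (N \<delta>) * (\<gamma> * \<delta>)" using \<eta> by (intro mult_left_mono) auto
    also have "\<dots> = \<gamma> * (real (N \<delta>) * \<delta>)" by simp
    also have "\<dots> \<le> \<gamma> * C" using elim gamma_pos by (intro mult_left_mono) auto
    finally have N\<eta>: "real (N \<delta>) * \<eta> \<le> \<gamma> * C" .
    have "real (N \<delta>) * (s \<delta>)\<^sup>2
        \<le> 2 * E\<^sup>2 + real (N \<delta>) * \<eta> * (4 * E + 4 * (real (N \<delta>) * \<eta>) + 10 * \<eta>)"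
      using perturbed_iterates_residual[where T = T and v = "dgd_v R \<alpha> X (y \<delta>)", OF T_firm T_fixed dgd_Suc, of "N \<delta>"]
      by (simp add: s_def v_def E_def \<eta>_def)
    also have "\<dots> = 2 * E\<^sup>2 + real (N \<delta>) * (\<eta> * (4 * E + 4 * (real (N \<delta>) * \<eta>) + 10 * \<eta>))" by simp
    also have "\<eta> * (4 * E + 4 * (real (N \<delta>) * \<eta>) + 10 * \<eta>)
        \<le> \<gamma> * \<delta> * (4 * E + 4 * (\<gamma> * C) + 10 * (\<gamma> * \<delta>))"
    proof (rule mult_mono[OF \<eta>(2)])
      show "4 * E + 4 * (real (N \<delta>) * \<eta>) + 10 * \<eta> \<le> 4 * E + 4 * (\<gamma> * C) + 10 * (\<gamma> * \<delta>)"
        using \<eta>(2) N\<eta> by linarith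
    qed (use \<eta> elim gamma_pos in \<open>auto simp: E_def\<close>)
    finally show ?case using elim by (simp add: B_def field_simps)
  qed
  moreover have "(B \<longlongrightarrow> 0) (at_right 0)"
  proof -
    have "((\<lambda>\<delta>. 2 * E\<^sup>2 / real (N \<delta>)) \<longlongrightarrow> 0) (at_right 0)"
      by (rule real_tendsto_divide_at_top[OF tendsto_const Nreal])
    moreover have "((\<lambda>\<delta>. \<gamma> * \<delta> * (4 * E + 4 * (\<gamma> * C) + 10 * (\<gamma> * \<delta>))) \<longlongrightarrow>
        \<gamma> * 0 * (4 * E + 4 * (\<gamma> * C) + 10 * (\<gamma> * 0))) (at_right 0)"
      by (intro tendsto_intros)
    ultimately show ?thesis unfolding B_def by (intro tendsto_add_zero) simp_all
  qed
  ultimately have s_lim: "(s \<longlongrightarrow> 0) (at_right 0)" by (rule tendsto_zero_of_power2_le)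
  \<comment> \<open>The dual error stays below \<open>E + \<gamma> * C\<close>, so the vanishing
    residual alone drives the primal error to 0.\<close>
  have "\<forall>\<^sub>F \<delta> in at_right 0. (norm (w (v \<delta>) - wd))\<^sup>2 \<le> (E + \<gamma> * C) * s \<delta> / (\<gamma> * \<alpha>)"
    using small C
  proof eventually_elim
    case (elim \<delta>)
    have "norm (v \<delta> - vd) \<le> E + real (N \<delta>) * norm (\<gamma> *\<^sub>R (X *v wd - y \<delta>))"
      using perturbed_iterates_dist[where T = T and v = "dgd_v R \<alpha> X (y \<delta>)" and u = "\<lambda>_. vd", OF T_nonexpansive dgd_Suc, of "N \<delta>"]
      by (simp add: T_fixed v_def E_def)
    also have "\<dots> \<le> E + real (N \<delta>) * (\<gamma> * \<delta>)"
      using noise' elim by (intro add_left_mono mult_left_mono) auto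
    also have "\<dots> = E + \<gamma> * (real (N \<delta>) * \<delta>)" by simp
    also have "\<dots> \<le> E + \<gamma> * C" using elim gamma_pos by (intro add_left_mono mult_left_mono) auto
    finally have "norm (v \<delta> - vd) * s \<delta> / \<gamma> \<le> (E + \<gamma> * C) * s \<delta> / \<gamma>"
      using gamma_pos by (intro divide_right_mono mult_right_mono) (auto simp: s_def)
    with primal_error_le_residual[of "v \<delta>"] have "\<alpha> * (norm (w (v \<delta>) - wd))\<^sup>2 \<le> (E + \<gamma> * C) * s \<delta> / \<gamma>"
      by (simp add: s_def)
    then show ?case using alpha gamma_pos by (simp add: field_simps)
  qed
  moreover have "((\<lambda>\<delta>. (E + \<gamma> * C) * s \<delta> / (\<gamma> * \<alpha>)) \<longlongrightarrow> 0) (at_right 0)"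
    using s_lim alpha gamma_pos by (auto intro!: tendsto_eq_intros)
  ultimately have "((\<lambda>\<delta>. norm (w (v \<delta>) - wd)) \<longlongrightarrow> 0) (at_right 0)"
    by (rule tendsto_zero_of_power2_le)
  then show ?thesis
    unfolding dgd_w_def v_def[symmetric] by (simp only: tendsto_norm_zero_iff LIM_zero_iff)
qed

text \<open>The index \<open>N\<close> is arbitrary so that the stopping time and both its
  neighbours can be treated alike.\<close>

lemma dgd_w_identifies:
  assumes noise: "\<And>\<delta>. 0 < \<delta> \<Longrightarrow> \<delta> < 1 \<Longrightarrow> norm (y \<delta> - X *v wd) \<le> \<delta>"
    and dual_limit: "(\<lambda>j. dgd_v R \<alpha> X (X *v wd) j) \<longlonglongrightarrow> vd"
    and N: "filterlim N at_top (at_right 0)"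
    and wd: "wd \<in> M" and \<epsilon>: "0 < \<epsilon>"
    and D: "\<forall>\<^sub>F \<delta> in at_right 0. \<alpha> * (real (N \<delta>) * \<delta>) / L \<le> D"
      "ereal D < set_edist (wd + - (transpose X *v vd)) (frontier (active_region R \<alpha> M wd \<epsilon>))"
  shows "\<forall>\<^sub>F \<delta> in at_right 0. dgd_w R \<alpha> X (y \<delta>) (N \<delta>) \<in> M"
proof -
  let ?U = "active_region R \<alpha> M wd \<epsilon>"
  define v where "v \<delta> = dgd_v R \<alpha> X (y \<delta>) (N \<delta>)" for \<delta>
  define v0 where "v0 = dgd_v R \<alpha> X (X *v wd)"
  \<comment> \<open>\<open>D\<close> bounds the accumulated noise; the gap \<open>D' - D\<close> is
    reserved for the primal error and the noiseless dual error, which both tend to 0.\<close>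
  obtain D' where D': "ereal D < ereal D'"
      "ereal D' < set_edist (wd + - (transpose X *v vd)) (frontier ?U)"
    using ereal_dense2[OF D(2)] by auto
  have small: "\<forall>\<^sub>F \<delta> in at_right 0. 0 < \<delta> \<and> \<delta> < (1::real)"
    by (auto simp: eventually_at_right_field intro: exI[of _ 1])
  have C: "\<forall>\<^sub>F \<delta> in at_right 0. real (N \<delta>) * \<delta> \<le> D * L / \<alpha>"
    using D(1)
  proof (rule eventually_mono)
    show "real (N \<delta>) * \<delta> \<le> D * L / \<alpha>" if "\<alpha> * (real (N \<delta>) * \<delta>) / L \<le> D" for \<delta>
      using that alpha L_pos by (simp add: field_simps)
  qed
  have w_lim: "((\<lambda>\<delta>. w (v \<delta>)) \<longlongrightarrow> wd) (at_right 0)"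
    using dgd_w_tendsto[where y = y and N = N, OF noise N C] by (simp add: dgd_w_def v_def)
  have v0_lim: "((\<lambda>\<delta>. v0 (N \<delta>)) \<longlongrightarrow> vd) (at_right 0)"
    using filterlim_compose[OF dual_limit N] by (simp add: v0_def)
  have "((\<lambda>\<delta>. norm (w (v \<delta>) - wd) + L * norm (v0 (N \<delta>) - vd)) \<longlongrightarrow> norm (wd - wd) + L * norm (vd - vd)) (at_right 0)"
    by (intro tendsto_intros w_lim v0_lim)
  then have "\<forall>\<^sub>F \<delta> in at_right 0. norm (w (v \<delta>) - wd) + L * norm (v0 (N \<delta>) - vd) < D' - D"
    by (rule order_tendstoD) (use D' in auto)
  with small D(1) show ?thesis
  proof eventually_elim
    case (elim \<delta>)
    have v0_Suc: "v0 (Suc j) = T (v0 j)" for j unfolding v0_def by (rule dgd_noiseless_Suc)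
    have "norm (v \<delta> - v0 (N \<delta>)) \<le> real (N \<delta>) * norm (\<gamma> *\<^sub>R (X *v wd - y \<delta>))"
      using perturbed_iterates_dist[where T = T and v = "dgd_v R \<alpha> X (y \<delta>)" and u = v0
          and b = "\<gamma> *\<^sub>R (X *v wd - y \<delta>)" and j = "N \<delta>", OF T_nonexpansive dgd_Suc v0_Suc]
      by (simp add: v_def v0_def)
    also have "\<dots> \<le> real (N \<delta>) * (\<gamma> * \<delta>)"
      using noise[of \<delta>] elim gamma_pos by (intro mult_left_mono) (auto simp: norm_minus_commute)
    finally have "L * norm (v \<delta> - v0 (N \<delta>)) \<le> L * (real (N \<delta>) * (\<gamma> * \<delta>))"
      using L_pos by (intro mult_left_mono) auto
    also have "\<dots> = \<alpha> * (real (N \<delta>) * \<delta>) / L"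
      using L_pos by (simp add: \<gamma>_def power2_eq_square)
    finally have 1: "L * norm (v \<delta> - v0 (N \<delta>)) \<le> D" using elim by linarith
    have "norm (v \<delta> - vd) \<le> norm (v \<delta> - v0 (N \<delta>)) + norm (v0 (N \<delta>) - vd)"
      using norm_triangle_ineq[of "v \<delta> - v0 (N \<delta>)" "v0 (N \<delta>) - vd"] by simp
    then have "L * norm (v \<delta> - vd) \<le> L * (norm (v \<delta> - v0 (N \<delta>)) + norm (v0 (N \<delta>) - vd))"
      using L_pos by (intro mult_left_mono) auto
    then have 2: "L * norm (v \<delta> - vd) \<le> D + L * norm (v0 (N \<delta>) - vd)"
      using 1 by (simp add: distrib_left)
    have "dist (wd + - (transpose X *v vd)) (w (v \<delta>) - transpose X *v v \<delta>)
        = norm ((wd - w (v \<delta>)) + transpose X *v (v \<delta> - vd))"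
      by (simp add: dist_norm matrix_vector_mult_diff_distrib algebra_simps)
    also have "\<dots> \<le> norm (wd - w (v \<delta>)) + L * norm (v \<delta> - vd)"
      using norm_triangle_ineq[of "wd - w (v \<delta>)" "transpose X *v (v \<delta> - vd)"]
        norm_transpose_mult_le[of X "v \<delta> - vd"] by linarith
    also have "\<dots> < D'" using 2 elim by (simp add: norm_minus_commute)
    finally have "ereal (dist (wd + - (transpose X *v vd)) (w (v \<delta>) - transpose X *v v \<delta>))
        < set_edist (wd + - (transpose X *v vd)) (frontier ?U)"
      using less_trans[OF _ D'(2)] by simp
    \<comment> \<open>The centre belongs to the region through \<open>wd\<close> itself, a point of
      \<open>M\<close> in the ball, with the subgradient from \<open>source\<close>.\<close>
    moreover have "wd + - (transpose X *v vd) \<in> ?U"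
      unfolding active_region_def using wd \<epsilon> source by (intro UN_I[of wd] imageI) auto
    ultimately have "w (v \<delta>) - transpose X *v v \<delta> \<in> ?U"
      by (rule mem_of_dist_less_frontier[rotated])
    then obtain p z where "p \<in> M" "z \<in> subdiff (reg_fun R \<alpha>) p" "w (v \<delta>) - transpose X *v v \<delta> = p + z"
      by (auto simp: active_region_def)
    then show ?case using primal_eqI[of z p "v \<delta>"] by (simp add: dgd_w_def v_def)
  qed
qed

end

section \<open>The stopping time and its neighbouring indices\<close>

lemma optimal_stopping_time_at_top:
  assumes "optimal_stopping_time k"
  shows "filterlim k at_top (at_right 0)"
proof -
  obtain c c_min c_max where c: "0 < c_min" "\<forall>\<delta>\<in>{0<..<1}. c_min \<le> c \<delta> \<and> c \<delta> \<le> c_max"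
      "\<forall>\<delta>\<in>{0<..<1}. \<delta> \<le> c \<delta> \<longrightarrow> k \<delta> \<in> {nat \<lfloor>c \<delta> / \<delta>\<rfloor>..2 * nat \<lfloor>c \<delta> / \<delta>\<rfloor>}"
    using assms unfolding optimal_stopping_time_def by blast
  \<comment> \<open>The threshold gives \<open>\<delta> * (real Z + 1) \<le> c \<delta>\<close>,
    which yields both \<open>Z \<le> c \<delta> / \<delta>\<close> and the condition
    \<open>\<delta> \<le> c \<delta>\<close> under which the range of \<open>k \<delta>\<close> is
    known.\<close>
  have "Z \<le> k \<delta>" if \<delta>: "0 < \<delta>" "\<delta> < min 1 (c_min / (real Z + 1))" for Z \<delta>
  proof -
    have m: "c_min \<le> c \<delta>" using c(2) \<delta> by simp
    have "\<delta> * (real Z + 1) \<le> c_min" using \<delta> by (simp add: field_simps)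
    then have *: "\<delta> * (real Z + 1) \<le> c \<delta>" using m by linarith
    have "real Z \<le> c \<delta> / \<delta>" using * \<delta> by (simp add: field_simps)
    then have Z: "Z \<le> nat \<lfloor>c \<delta> / \<delta>\<rfloor>" by (simp add: le_nat_iff le_floor_iff)
    have "\<delta> * 1 \<le> \<delta> * (real Z + 1)" using \<delta> by (intro mult_left_mono) auto
    then have "\<delta> \<le> c \<delta>" using * by linarith
    then have "nat \<lfloor>c \<delta> / \<delta>\<rfloor> \<le> k \<delta>" using c(3) \<delta> by simp
    with Z show ?thesis by simp
  qed
  moreover have "0 < min 1 (c_min / (real Z + 1))" for Z using c(1) by simp
  ultimately show ?thesis
    unfolding filterlim_at_top eventually_at_right_field by metis
qed

theorem theorem4p1:
  fixes X :: "real^'p^'n" and R :: "real^'p \<Rightarrow> ereal" and \<alpha> \<epsilon> :: real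
    and wd :: "real^'p" and vd :: "real^'n" and M :: "(real^'p) set"
    and y :: "real \<Rightarrow> real^'n" and k :: "real \<Rightarrow> nat"
  assumes X_nonzero: "X \<noteq> 0"
    and R: "proper_fun R" "convex_fun R" "lsc_fun R"
    and alpha: "0 < \<alpha>"
    and noise: "\<And>\<delta>. 0 < \<delta> \<Longrightarrow> \<delta> < 1 \<Longrightarrow>
                  y \<delta> \<in> range (\<lambda>w. X *v w) \<and> norm (y \<delta> - X *v wd) \<le> \<delta>"
    and stopping: "optimal_stopping_time k"
    and unique_primal: "{w. is_arg_min (reg_fun R \<alpha>) (\<lambda>w. X *v w = X *v wd) w} = {wd}"
    and dual_solution: "is_arg_min (dual_objective R \<alpha> X (X *v wd)) (\<lambda>_. True) vd"
    and dual_limit: "(\<lambda>j. dgd_v R \<alpha> X (X *v wd) j) \<longlonglongrightarrow> vd"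
    and source: "- (transpose X *v vd) \<in> rel_interior (subdiff (reg_fun R \<alpha>) wd)"
    and partly_smooth: "partly_smooth R wd M"
    and eps: "0 < \<epsilon>"
    and margin: "noise_margin \<alpha> X k
                   (set_edist (wd + - (transpose X *v vd)) (frontier (active_region R \<alpha> M wd \<epsilon>)))"
  shows "\<exists>\<delta>0>0. \<forall>\<delta>. 0 < \<delta> \<and> \<delta> < \<delta>0 \<and> \<delta> < 1 \<longrightarrow>
           dgd_w R \<alpha> X (y \<delta>) (k \<delta>) \<in> M \<and>
           (\<exists>k_lo k_hi :: nat. 0 < k_lo \<and> k_lo < k \<delta> \<and> k \<delta> < k_hi \<and>
              (\<forall>j\<in>{k_lo..k_hi}. dgd_w R \<alpha> X (y \<delta>) j \<in> M))"
proof -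
  interpret dual_descent X R \<alpha> wd vd
  proof
    show "- (transpose X *v vd) \<in> subdiff (reg_fun R \<alpha>) wd"
      using source rel_interior_subset by blast
    show "subdiff R wd \<noteq> {}" using partly_smooth by (simp add: partly_smooth_def)
  qed (use X_nonzero R alpha in auto)
  let ?D = "set_edist (wd + - (transpose X *v vd)) (frontier (active_region R \<alpha> M wd \<epsilon>))"
  let ?c = "\<lambda>\<delta>. \<alpha> * stopping_const k \<delta> / L"
  have wd: "wd \<in> M" using partly_smooth by (simp add: partly_smooth_def)
  have k: "filterlim k at_top (at_right 0)" by (rule optimal_stopping_time_at_top[OF stopping])
  have small: "\<forall>\<^sub>F \<delta> in at_right 0. 0 < \<delta> \<and> \<delta> < (1::real)"
    by (auto simp: eventually_at_right_field intro: exI[of _ 1])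
  obtain D1 where D1: "Limsup (at_right 0) (\<lambda>\<delta>. ereal (?c \<delta>)) < ereal D1" "ereal D1 < ?D"
    using margin ereal_dense2 unfolding noise_margin_def by blast
  \<comment> \<open>Room for one more iteration: its contribution
    \<open>\<alpha> * \<delta> / L\<close> is eventually below \<open>D2 - D1\<close>.\<close>
  obtain D2 where D2: "ereal D1 < ereal D2" "ereal D2 < ?D"
    using ereal_dense2[OF D1(2)] by auto
  have c: "\<forall>\<^sub>F \<delta> in at_right 0. ?c \<delta> < D1"
    using Limsup_lessD[OF D1(1)] by simp
  have "((\<lambda>\<delta>. \<alpha> * \<delta> / L) \<longlongrightarrow> \<alpha> * 0 / L) (at_right 0)"
    using L_pos by (intro tendsto_intros) auto
  then have "\<forall>\<^sub>F \<delta> in at_right 0. \<alpha> * \<delta> / L < D2 - D1"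
    by (rule order_tendstoD) (use D2 in auto)
  with small c have bound: "\<forall>\<^sub>F \<delta> in at_right 0. \<alpha> * ((real (k \<delta>) + 1) * \<delta>) / L \<le> D2"
  proof eventually_elim
    case (elim \<delta>)
    have "\<alpha> * ((real (k \<delta>) + 1) * \<delta>) / L = ?c \<delta> + \<alpha> * \<delta> / L"
      by (simp add: stopping_const_def distrib_left distrib_right add_divide_distrib mult_ac)
    with elim show ?case by linarith
  qed
  have ident: "\<forall>\<^sub>F \<delta> in at_right 0. dgd_w R \<alpha> X (y \<delta>) (N \<delta>) \<in> M"
    if N: "filterlim N at_top (at_right 0)" and le: "\<And>\<delta>. N \<delta> \<le> Suc (k \<delta>)" for N
  proof (rule dgd_w_identifies[OF _ dual_limit N wd eps _ D2(2)])
    show "\<forall>\<^sub>F \<delta> in at_right 0. \<alpha> * (real (N \<delta>) * \<delta>) / L \<le> D2"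
      using small bound
    proof eventually_elim
      case (elim \<delta>)
      have "real (N \<delta>) \<le> real (k \<delta>) + 1" using le[of \<delta>] by linarith
      then have "\<alpha> * (real (N \<delta>) * \<delta>) / L \<le> \<alpha> * ((real (k \<delta>) + 1) * \<delta>) / L"
        using alpha L_pos elim by (intro divide_right_mono mult_left_mono mult_right_mono) auto
      with elim show ?case by linarith
    qed
  qed (use noise in blast)
  have k_ge: "\<forall>\<^sub>F \<delta> in at_right 0. Z \<le> k \<delta>" for Z using k by (simp add: filterlim_at_top)
  have k_pred: "filterlim (\<lambda>\<delta>. k \<delta> - 1) at_top (at_right 0)"
    unfolding filterlim_at_top
  proof
    show "\<forall>\<^sub>F \<delta> in at_right 0. Z \<le> k \<delta> - 1" for Z
      using k_ge[of "Suc Z"] by (rule eventually_mono) simp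
  qed
  have k_Suc: "filterlim (\<lambda>\<delta>. Suc (k \<delta>)) at_top (at_right 0)"
    using filterlim_compose[OF filterlim_Suc k] .
  have identified: "\<forall>\<^sub>F \<delta> in at_right 0. dgd_w R \<alpha> X (y \<delta>) (k \<delta> - 1) \<in> M"
    "\<forall>\<^sub>F \<delta> in at_right 0. dgd_w R \<alpha> X (y \<delta>) (k \<delta>) \<in> M"
    "\<forall>\<^sub>F \<delta> in at_right 0. dgd_w R \<alpha> X (y \<delta>) (Suc (k \<delta>)) \<in> M"
    by ((rule ident[OF k_pred] ident[OF k] ident[OF k_Suc]; simp)+)
  have "\<forall>\<^sub>F \<delta> in at_right 0. dgd_w R \<alpha> X (y \<delta>) (k \<delta>) \<in> M \<and>
      (\<exists>k_lo k_hi :: nat. 0 < k_lo \<and> k_lo < k \<delta> \<and> k \<delta> < k_hi \<and>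
        (\<forall>j\<in>{k_lo..k_hi}. dgd_w R \<alpha> X (y \<delta>) j \<in> M))"
    \<comment> \<open>From \<open>2 \<le> k \<delta>\<close> the lower end
      \<open>k \<delta> - 1\<close> is positive and truly below \<open>k \<delta>\<close>. The
      interval has just three indices, so finitely many eventual statements cover it.\<close>
    using identified k_ge[of 2]
  proof eventually_elim
    case (elim \<delta>)
    have "dgd_w R \<alpha> X (y \<delta>) j \<in> M" if "j \<in> {k \<delta> - 1..Suc (k \<delta>)}" for j
    proof -
      have "j = k \<delta> - 1 \<or> j = k \<delta> \<or> j = Suc (k \<delta>)" using that by auto
      with elim show ?thesis by auto
    qed
    then show ?case
      using elim by (intro conjI exI[of _ "k \<delta> - 1"] exI[of _ "Suc (k \<delta>)"]) auto
  qed
  then show ?thesis unfolding eventually_at_right_field by auto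
qed

end
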